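(* Let $\alpha,\beta,\gamma>0$, let $\phi$ and $V_\phi$ be as described in the context, let $0<\rho<(\lim_{x\to\infty}\phi(x))^{\alpha}$, and let $X$ be the random variable with values in $\mathbb{N}=\{0,1,2,\dots\}$ and probability mass function $$\mathbb{P}(X=n)=\frac{\Gamma(n+\gamma)\,\rho^n}{n!\,V_\phi(\alpha n+\beta)}\,\frac{1}{Z_{\alpha,\beta,\gamma}(\rho,\phi)},\qquad n\in\mathbb{N},$$ where, for all $a,b,c>0$, $Z_{a,b,c}(\rho,\phi)=\sum_{k=0}^\infty\frac{\Gamma(k+c)\,\rho^k}{k!\,V_\phi(ak+b)}$. Then the factorial moments $m_s=\mathbb{E}[X(X-1)\cdots(X-s+1)]$ of $X$ are $$m_s=\rho^s\,\frac{Z_{\alpha,\,s\alpha+\beta,\,\gamma+s}(\rho,\phi)}{Z_{\alpha,\beta,\gamma}(\rho,\phi)},\qquad s\in\mathbb{N}.$$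
   Context: The function $\phi:(0,\infty)\to(0,\infty)$ and the associated function $V_\phi:(0,\infty)\to(0,\infty)$ are of one of the following two types. (1) $\phi$ is a Bernstein function, i.e. $\phi\in\mathcal{C}^\infty$, $\phi\ge0$, and $(-1)^{n-1}\phi^{(n)}\ge0$ on $(0,\infty)$ for all integers $n\ge1$, and $V_\phi=W_\phi$ is the Bernstein-gamma function of $\phi$: the unique positive log-convex function on $(0,\infty)$ with $W_\phi(1)=1$ and $W_\phi(x+1)=\phi(x)W_\phi(x)$ for all $x>0$. (2) $\phi$ is eventually log-convex (there is $m\in\mathbb{R}$ such that $\log\phi$ is convex on $(m,\infty)\cap(0,\infty)$) with $\lim_{n\to\infty}\phi(n)/\phi(n+1)=1$, and $V_\phi=\widetilde W_\phi$, where $\widetilde W_\phi(x)=\lim_{n\to\infty}\frac{\phi(n)\cdots\phi(1)\,(\phi(n))^x}{\phi(n+x)\phi(n-1+x)\cdots\phi(x)}$ for $x>0$; this satisfies $\widetilde W_\phi(1)=1$ and $\widetilde W_\phi(x+1)=\phi(x)\widetilde W_\phi(x)$. The limit $\lim_{x\to\infty}\phi(x)$ may be $+\infty$, in which case $\rho$ is any positive number. For $s=0$ the empty product is $1$. *)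

theory Defs
  imports "HOL-Probability.Probability"
begin

text \<open>
  Functions on \<open>(0,\<infinity>)\<close> are rendered as functions on \<^typ>\<open>real\<close> of which only the values at
  positive arguments are constrained or used.
\<close>

definition bernstein_function :: "(real \<Rightarrow> real) \<Rightarrow> bool" where
  "bernstein_function \<phi> \<longleftrightarrow>
     (\<forall>n. (deriv ^^ n) \<phi> differentiable_on {0<..}) \<and>
     (\<forall>x>0. \<phi> x \<ge> 0) \<and>
     (\<forall>n\<ge>1. \<forall>x>0. (-1) ^ (n - 1) * (deriv ^^ n) \<phi> x \<ge> 0)"

text \<open>
  The conditions below determine the values of \<open>W\<close> on \<open>(0,\<infinity>)\<close> uniquely when \<open>\<phi>\<close> is a
  positive Bernstein function, so the Bernstein-gamma function is given as a relation.
\<close>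

definition bernstein_gamma :: "(real \<Rightarrow> real) \<Rightarrow> (real \<Rightarrow> real) \<Rightarrow> bool" where
  "bernstein_gamma \<phi> W \<longleftrightarrow>
     (\<forall>x>0. W x > 0) \<and>
     convex_on {0<..} (\<lambda>x. ln (W x)) \<and>
     W 1 = 1 \<and>
     (\<forall>x>0. W (x + 1) = \<phi> x * W x)"

definition eventually_log_convex :: "(real \<Rightarrow> real) \<Rightarrow> bool" where
  "eventually_log_convex \<phi> \<longleftrightarrow> (\<exists>m. convex_on ({m<..} \<inter> {0<..}) (\<lambda>x. ln (\<phi> x)))"

definition limit_gamma :: "(real \<Rightarrow> real) \<Rightarrow> (real \<Rightarrow> real) \<Rightarrow> bool" where
  "limit_gamma \<phi> W \<longleftrightarrow>
     (\<forall>x>0. (\<lambda>n. (\<Prod>k=1..n. \<phi> (real k)) * \<phi> (real n) powr x / (\<Prod>k=0..n. \<phi> (real k + x)))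
              \<longlonglongrightarrow> W x)"

definition admissible_pair :: "(real \<Rightarrow> real) \<Rightarrow> (real \<Rightarrow> real) \<Rightarrow> bool" where
  "admissible_pair \<phi> V \<longleftrightarrow>
     (\<forall>x>0. \<phi> x > 0) \<and> (\<forall>x>0. V x > 0) \<and>
     (bernstein_function \<phi> \<and> bernstein_gamma \<phi> V \<or>
      eventually_log_convex \<phi> \<and> (\<lambda>n. \<phi> (real n) / \<phi> (real (n + 1))) \<longlonglongrightarrow> 1 \<and> limit_gamma \<phi> V)"

text \<open>\<open>Z_series V a b c \<rho>\<close> is $Z_{a,b,c}(\rho,\phi)$; it depends on $\phi$ only through \<open>V\<close>.\<close>

definition Z_series :: "(real \<Rightarrow> real) \<Rightarrow> real \<Rightarrow> real \<Rightarrow> real \<Rightarrow> real \<Rightarrow> real" where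
  "Z_series V a b c \<rho> =
     (\<Sum>k. Gamma (real k + c) * \<rho> ^ k / (fact k * V (a * real k + b)))"

end

theory Submission
  imports Defs
begin

text \<open>
  Formally the identity is an index shift: the falling factorial \<open>n(n-1)\<cdots>(n-s+1)\<close> cancels
  against \<open>n!\<close> and kills the terms with \<open>n < s\<close>, and writing \<open>n = k + s\<close> turns the remaining
  series into \<open>\<rho>\<^sup>s\<close> times the series for \<open>Z\<close> with parameters \<open>\<alpha>\<close>, \<open>s\<alpha> + \<beta>\<close>, \<open>\<gamma> + s\<close>.

  The analytic content is that this shifted series converges, which the mere existence of \<open>X\<close>
  does not give (it yields convergence for \<open>s = 0\<close> only). The hypothesis \<open>\<rho> < L\<^sup>\<alpha>\<close>, with \<open>L\<close> the
  limit of \<open>\<phi>\<close>, enters here: pick \<open>c\<close> with \<open>\<rho> < c\<^sup>\<alpha>\<close> and \<open>c < L\<close>. Then \<open>\<phi> \<ge> c\<close> far out, so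
  that \<open>V (x + 1) \<ge> c V x\<close>, and \<open>V y\<close> dominates a multiple of \<open>c\<close> to the power \<open>y\<close> as soon as \<open>V\<close>
  is bounded away from \<open>0\<close> on one interval of length one (\<open>admissible_pair_growth\<close>).
  The series is therefore dominated by a negative binomial series with ratio
  \<open>\<rho> / c\<^sup>\<alpha> < 1\<close> (\<open>Z_series_summable\<close>).

  Both properties of \<open>V\<close> used for this follow from (log-)convexity. A log-convex \<open>V\<close> is
  continuous. If \<open>V\<close> is given by the limit formula, \<open>1/V\<close> is, far out, a limit of products of
  log-convex functions, hence \<open>V\<close> lies above the smaller of its values at the ends of an interval
  (\<open>limit_gamma_ge_min\<close>); and the inequality \<open>V (x + 1) \<ge> \<phi> x * V x\<close>, one half of the functional
  equation, follows by comparing \<open>\<phi>\<close> between two consecutive integers with its values there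
  (\<open>limit_gamma_step\<close>).
\<close>

section \<open>Lower bounds for functions given by the limit formula\<close>

lemma convex_on_le_max_endpoints:
  fixes f :: "real \<Rightarrow> real"
  assumes "convex_on S f" "a \<in> S" "b \<in> S" "a \<le> x" "x \<le> b"
  shows "f x \<le> max (f a) (f b)"
proof (cases "a = b")
  case True
  then show ?thesis using assms by auto
next
  case False
  define t where "t = (x - a) / (b - a)"
  have t: "0 \<le> t" "t \<le> 1" using assms False by (auto simp: t_def field_simps)
  have "t * (b - a) = x - a" using False by (simp add: t_def)
  then have x: "x = (1 - t) * a + t * b" by (simp add: algebra_simps)
  have "f x \<le> (1 - t) * f a + t * f b"
    using convex_onD[OF assms(1) t assms(2,3)] x by simp
  also have "\<dots> \<le> (1 - t) * max (f a) (f b) + t * max (f a) (f b)"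
    using t by (intro add_mono mult_left_mono) auto
  finally show ?thesis by (simp add: algebra_simps)
qed

text \<open>
  Each approximant has a logarithm that is affine in \<open>x\<close> minus a sum of translates of \<open>ln \<phi>\<close>,
  hence is concave; concavity bounds it from below by its values at the endpoints, and
  this bound survives the limit.
\<close>
lemma limit_gamma_ge_min:
  fixes \<phi> V :: "real \<Rightarrow> real"
  assumes lim: "limit_gamma \<phi> V" and pos: "\<And>x. x > 0 \<Longrightarrow> \<phi> x > 0"
    and cvx: "convex_on ({m<..} \<inter> {0<..}) (\<lambda>x. ln (\<phi> x))"
    and ab: "m < a" "0 < a" "a \<le> x" "x \<le> b"
  shows "min (V a) (V b) \<le> V x"
proof -
  define P where "P n x = (\<Prod>k=1..n. \<phi> (real k)) * \<phi> (real n) powr x / (\<Prod>k=0..n. \<phi> (real k + x))"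
    for n :: nat and x
  have P: "(\<lambda>n. P n y) \<longlonglongrightarrow> V y" if "y > 0" for y
    using lim that by (simp add: limit_gamma_def P_def)
  have "min (P n a) (P n b) \<le> P n x" if n: "n \<ge> 1" for n
  proof -
    define K where "K = ln (\<Prod>k=1..n. \<phi> (real k))"
    define g where "g y = (\<Sum>k=0..n. ln (\<phi> (real k + y))) + (- ln (\<phi> (real n)) * y)" for y
    have ppos: "P n y > 0" if "y > 0" for y
      unfolding P_def using pos[of "real n"] that n
      by (intro divide_pos_pos mult_pos_pos prod_pos) (auto intro!: pos)
    have lnP: "ln (P n y) = K - g y" if "y > 0" for y
    proof -
      have p1: "(\<Prod>k=1..n. \<phi> (real k)) > 0" and p2: "(\<Prod>k=0..n. \<phi> (real k + y)) > 0"
        using that by (auto intro!: prod_pos pos)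
      have "ln (\<Prod>k=0..n. \<phi> (real k + y)) = (\<Sum>k=0..n. ln (\<phi> (real k + y)))"
        using that by (intro ln_prod) (auto intro!: pos less_imp_neq[THEN not_sym])
      moreover have "ln (P n y) = K + y * ln (\<phi> (real n)) - ln (\<Prod>k=0..n. \<phi> (real k + y))"
        unfolding P_def K_def using p1 p2 pos[of "real n"] n
        by (simp add: ln_div ln_mult ln_powr less_imp_neq[THEN not_sym] del: prod_zero_iff prod_eq_1_iff)
      ultimately show ?thesis by (simp add: g_def)
    qed
    have shifted: "convex_on ({m<..} \<inter> {0<..}) (\<lambda>y. ln (\<phi> (real k + y)))" for k
    proof (rule convex_onI)
      show "convex ({m<..} \<inter> {0::real<..})" by (intro convex_Int) auto
    next
      fix t u v :: real
      assume t: "0 < t" "t < 1" and uv: "u \<in> {m<..} \<inter> {0<..}" "v \<in> {m<..} \<inter> {0<..}"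
      have "real k + ((1 - t) *\<^sub>R u + t *\<^sub>R v) = (1 - t) *\<^sub>R (real k + u) + t *\<^sub>R (real k + v)"
        by (simp add: algebra_simps)
      then show "ln (\<phi> (real k + ((1 - t) *\<^sub>R u + t *\<^sub>R v)))
          \<le> (1 - t) * ln (\<phi> (real k + u)) + t * ln (\<phi> (real k + v))"
        using convex_onD[OF cvx, of t "real k + u" "real k + v"] t uv by auto
    qed
    have sum: "convex_on ({m<..} \<inter> {0<..}) (\<lambda>y. \<Sum>k=0..n. ln (\<phi> (real k + y)))"
    proof (induction n)
      case 0
      show ?case using shifted[of 0] by simp
    next
      case (Suc n)
      show ?case using convex_on_add[OF Suc shifted[of "Suc n"]] by simp
    qed
    have "convex_on ({m<..} \<inter> {0<..}) (\<lambda>y. - ln (\<phi> (real n)) * y)"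
      by (rule convex_onI) (auto simp: algebra_simps intro!: convex_Int)
    with sum have "convex_on ({m<..} \<inter> {0<..}) g"
      unfolding g_def by (rule convex_on_add)
    then have "g x \<le> max (g a) (g b)"
      using ab by (intro convex_on_le_max_endpoints) auto
    then have "ln (P n a) \<le> ln (P n x) \<or> ln (P n b) \<le> ln (P n x)"
      using lnP[of a] lnP[of b] lnP[of x] ab by auto
    then show ?thesis
      using ppos[of a] ppos[of b] ppos[of x] ab by (auto simp: min_le_iff_disj)
  qed
  then have "\<forall>\<^sub>F n in sequentially. min (P n a) (P n b) \<le> P n x"
    using eventually_sequentially by blast
  moreover have "(\<lambda>n. min (P n a) (P n b)) \<longlonglongrightarrow> min (V a) (V b)"
    using P ab by (intro tendsto_min) auto
  ultimately show ?thesis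
    using P[of x] ab by (intro tendsto_le[OF trivial_limit_sequentially]) auto
qed

lemma consecutive_ratio_shift:
  fixes f :: "nat \<Rightarrow> real"
  assumes lim: "(\<lambda>n. f n / f (n + 1)) \<longlonglongrightarrow> 1" and pos: "\<And>n. n \<ge> 1 \<Longrightarrow> f n > 0"
  shows "(\<lambda>n. f n / f (n + k)) \<longlonglongrightarrow> 1"
proof (induction k)
  case 0
  have "\<forall>\<^sub>F n in sequentially. f n / f (n + 0) = 1"
    using eventually_ge_at_top[of 1] by eventually_elim (use pos in force)
  then show ?case by (simp add: tendsto_eventually)
next
  case (Suc k)
  have lim_prod: "(\<lambda>n. (f n / f (n + k)) * (f (n + k) / f (n + k + 1))) \<longlonglongrightarrow> 1 * 1"
    using Suc LIMSEQ_ignore_initial_segment[OF lim, of k] by (intro tendsto_mult) auto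
  have "\<forall>\<^sub>F n in sequentially.
      (f n / f (n + k)) * (f (n + k) / f (n + k + 1)) = f n / f (n + Suc k)"
    using eventually_ge_at_top[of 1]
  proof eventually_elim
    case (elim n)
    then show ?case using pos[of "n + k"] by simp
  qed
  from Lim_transform_eventually[OF lim_prod this] show ?case by simp
qed

text \<open>
  The approximants satisfy the functional equation up to the factor \<open>\<phi>(n) / \<phi>(n + x + 1)\<close>.
  By log-convexity, \<open>\<phi>(n + x + 1)\<close> is at most the larger of the values of \<open>\<phi>\<close> at the two
  neighbouring integers, each asymptotic to \<open>\<phi>(n)\<close>, so the limit of this factor is at least one.
\<close>
lemma limit_gamma_step:
  fixes \<phi> V :: "real \<Rightarrow> real"
  assumes lim: "limit_gamma \<phi> V" and pos: "\<And>x. x > 0 \<Longrightarrow> \<phi> x > 0"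
    and cvx: "convex_on ({m<..} \<inter> {0<..}) (\<lambda>x. ln (\<phi> x))"
    and ratio: "(\<lambda>n. \<phi> (real n) / \<phi> (real (n + 1))) \<longlonglongrightarrow> 1"
    and "x > 0"
  shows "\<phi> x * V x \<le> V (x + 1)"
proof -
  define P where "P n x = (\<Prod>k=1..n. \<phi> (real k)) * \<phi> (real n) powr x / (\<Prod>k=0..n. \<phi> (real k + x))"
    for n :: nat and x
  have P: "(\<lambda>n. P n y) \<longlonglongrightarrow> V y" if "y > 0" for y
    using lim that by (simp add: limit_gamma_def P_def)
  \<comment> \<open>With this \<open>j\<close>, the point \<open>n + x + 1\<close> lies between the integers \<open>n + j\<close> and \<open>n + j + 1\<close>.\<close>
  define j where "j = nat \<lfloor>x + 1\<rfloor>"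
  have j: "real j \<le> x + 1" "x + 1 \<le> real j + 1"
    using \<open>x > 0\<close> unfolding j_def by linarith+
  define r where "r n = min (\<phi> (real n) / \<phi> (real (n + j))) (\<phi> (real n) / \<phi> (real (n + (j + 1))))" for n
  have "(\<lambda>n. \<phi> (real n) / \<phi> (real (n + k))) \<longlonglongrightarrow> 1" for k
    by (rule consecutive_ratio_shift[where f = "\<lambda>n. \<phi> (real n)"]) (use ratio pos in auto)
  then have "r \<longlonglongrightarrow> min 1 1"
    unfolding r_def by (intro tendsto_min)
  then have "(\<lambda>n. r n * (\<phi> x * P n x)) \<longlonglongrightarrow> 1 * (\<phi> x * V x)"
    using P[of x] \<open>x > 0\<close> by (intro tendsto_mult) auto
  moreover have "\<forall>\<^sub>F n in sequentially. r n * (\<phi> x * P n x) \<le> P n (x + 1)"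
    using eventually_gt_at_top[of "nat \<lceil>max m 0\<rceil>"]
  proof eventually_elim
    case (elim n)
    then have n: "real n > m" "real n > 0" by linarith+
    have Ppos: "P n x > 0"
      unfolding P_def using pos[of "real n"] n \<open>x > 0\<close>
      by (intro divide_pos_pos mult_pos_pos prod_pos) (auto intro!: pos)
    have "(\<Prod>k=0..n. \<phi> (real k + (x + 1))) * \<phi> x = (\<Prod>k=0..Suc n. \<phi> (real k + x))"
      by (subst prod.atLeast0_atMost_Suc_shift) (simp add: add_ac mult.commute)
    also have "\<dots> = (\<Prod>k=0..n. \<phi> (real k + x)) * \<phi> (real n + x + 1)"
      by (simp add: add_ac)
    finally have prod: "(\<Prod>k=0..n. \<phi> (real k + (x + 1))) =
        (\<Prod>k=0..n. \<phi> (real k + x)) * \<phi> (real n + x + 1) / \<phi> x"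
      using pos[OF \<open>x > 0\<close>] by (simp add: field_simps)
    have eq: "P n (x + 1) = (\<phi> (real n) / \<phi> (real n + x + 1)) * (\<phi> x * P n x)"
      unfolding P_def prod using pos[of "real n"] n by (simp add: powr_add field_simps)
    have "ln (\<phi> (real n + x + 1)) \<le> max (ln (\<phi> (real (n + j)))) (ln (\<phi> (real (n + (j + 1)))))"
      using n j by (intro convex_on_le_max_endpoints[OF cvx]) auto
    then have "ln (\<phi> (real n + x + 1)) \<le> ln (\<phi> (real (n + j))) \<or>
        ln (\<phi> (real n + x + 1)) \<le> ln (\<phi> (real (n + (j + 1))))"
      by (simp add: le_max_iff_disj)
    moreover have fp: "\<phi> (real n) > 0" "\<phi> (real n + x + 1) > 0"
        "\<phi> (real (n + j)) > 0" "\<phi> (real (n + (j + 1))) > 0"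
      using n \<open>x > 0\<close> by (auto intro!: pos)
    ultimately have "\<phi> (real n + x + 1) \<le> \<phi> (real (n + j)) \<or>
        \<phi> (real n + x + 1) \<le> \<phi> (real (n + (j + 1)))"
      by simp
    then have "r n \<le> \<phi> (real n) / \<phi> (real n + x + 1)"
      unfolding r_def min_le_iff_disj using fp by (auto intro!: divide_left_mono)
    then show ?case
      unfolding eq using Ppos pos[OF \<open>x > 0\<close>] by (intro mult_right_mono) auto
  qed
  ultimately show ?thesis
    using P[of "x + 1"] \<open>x > 0\<close> by (intro tendsto_le[OF trivial_limit_sequentially]) auto
qed

section \<open>Exponential growth and convergence of the series\<close>

lemma admissible_pair_pos:
  assumes "admissible_pair \<phi> V" "x > 0"
  shows "\<phi> x > 0" "V x > 0"
  using assms unfolding admissible_pair_def by blast+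

text \<open>
  This is half of the functional equation, the form in which it drives growth estimates from below;
  for the limit formula, convexity of \<open>ln \<phi>\<close> gives this half directly, even when \<open>\<phi>\<close> is unbounded.
\<close>
lemma admissible_pair_step:
  assumes "admissible_pair \<phi> V" "x > 0"
  shows "\<phi> x * V x \<le> V (x + 1)"
proof (cases "bernstein_gamma \<phi> V")
  case True
  then show ?thesis using assms by (simp add: bernstein_gamma_def)
next
  case False
  then obtain m where "convex_on ({m<..} \<inter> {0<..}) (\<lambda>x. ln (\<phi> x))" "limit_gamma \<phi> V"
      "(\<lambda>n. \<phi> (real n) / \<phi> (real (n + 1))) \<longlonglongrightarrow> 1"
    using assms unfolding admissible_pair_def eventually_log_convex_def by blast
  then show ?thesis
    using assms admissible_pair_pos[OF assms(1)] by (intro limit_gamma_step)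
qed

text \<open>
  The anchor for the growth estimate: a log-convex \<open>V\<close> is continuous and attains its minimum on
  a compact interval, and for the limit formula the endpoint values serve as a bound, once the
  interval lies in the range where \<open>ln \<phi>\<close> is convex.
\<close>
lemma admissible_pair_bounded_below:
  assumes "admissible_pair \<phi> V"
  obtains m where "m > 0" "\<And>a. a > m \<Longrightarrow> \<exists>d>0. \<forall>x\<in>{a..a+1}. d \<le> V x"
proof -
  note pos = admissible_pair_pos(1)[OF assms] and Vpos = admissible_pair_pos(2)[OF assms]
  consider "bernstein_gamma \<phi> V" |
    m where "convex_on ({m<..} \<inter> {0<..}) (\<lambda>x. ln (\<phi> x))" "limit_gamma \<phi> V"
    using assms unfolding admissible_pair_def eventually_log_convex_def by blast
  then show thesis
  proof cases
    case 1
    then have "continuous_on {0<..} (\<lambda>x. ln (V x))"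
      by (intro convex_on_continuous) (auto simp: bernstein_gamma_def)
    then have "continuous_on {0<..} (\<lambda>x. exp (ln (V x)))"
      by (rule continuous_on_exp)
    moreover have "continuous_on {0<..} (\<lambda>x. exp (ln (V x))) \<longleftrightarrow> continuous_on {0<..} V"
      by (intro continuous_on_cong) (auto simp: Vpos)
    ultimately have cont: "continuous_on {0<..} V" by simp
    show thesis
    proof (rule that[of 1])
      fix a :: real assume a: "a > 1"
      have "continuous_on {a..a+1} V"
        using a by (intro continuous_on_subset[OF cont]) auto
      then obtain z where "z \<in> {a..a+1}" "\<forall>y\<in>{a..a+1}. V z \<le> V y"
        using continuous_attains_inf[of "{a..a+1}" V] by auto
      then show "\<exists>d>0. \<forall>x\<in>{a..a+1}. d \<le> V x"
        using a by (intro exI[of _ "V z"]) (auto intro!: Vpos)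
    qed auto
  next
    case (2 m)
    show thesis
    proof (rule that[of "max m 1"])
      fix a :: real assume a: "a > max m 1"
      then show "\<exists>d>0. \<forall>x\<in>{a..a+1}. d \<le> V x"
        using limit_gamma_ge_min[OF 2(2) pos 2(1), of a _ "a + 1"] Vpos[of a] Vpos[of "a + 1"]
        by (intro exI[of _ "min (V a) (V (a + 1))"]) auto
    qed auto
  qed
qed

text \<open>
  Every large \<open>y\<close> is reached by unit steps from a point of a fixed interval of length one;
  each step multiplies \<open>V\<close> by at least \<open>c\<close>. The constant absorbs the power of \<open>c\<close> lost at the
  starting point.
\<close>
lemma admissible_pair_growth:
  assumes adm: "admissible_pair \<phi> V" and "c > 0"
    and ev: "\<forall>\<^sub>F x in at_top. c \<le> \<phi> x"
  obtains D a where "D > 0" "\<And>y. y \<ge> a \<Longrightarrow> D * c powr y \<le> V y"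
proof -
  obtain m where m: "m > 0" "\<And>a. a > m \<Longrightarrow> \<exists>d>0. \<forall>x\<in>{a..a+1}. d \<le> V x"
    using admissible_pair_bounded_below[OF adm] by blast
  obtain b where b: "\<And>x. x \<ge> b \<Longrightarrow> c \<le> \<phi> x"
    using ev by (auto simp: eventually_at_top_linorder)
  define a where "a = max b (m + 1)"
  have a: "a > m" "a > 0" "a \<ge> b" using m(1) by (auto simp: a_def)
  obtain d where d: "d > 0" "\<And>x. x \<in> {a..a+1} \<Longrightarrow> d \<le> V x"
    using m(2)[OF a(1)] by blast
  note Vpos = admissible_pair_pos(2)[OF adm]
  have steps: "c ^ k * V x \<le> V (x + real k)" if "x \<ge> a" for x k
  proof (induction k)
    case (Suc k)
    have "c ^ Suc k * V x \<le> c * V (x + real k)"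
      using Suc \<open>c > 0\<close> by (simp add: mult.assoc)
    also have "\<dots> \<le> \<phi> (x + real k) * V (x + real k)"
      using that a b[of "x + real k"] Vpos[of "x + real k"] by (intro mult_right_mono) auto
    also have "\<dots> \<le> V (x + real k + 1)"
      using that a by (intro admissible_pair_step[OF adm]) auto
    finally show ?case by (simp add: add_ac)
  qed simp
  \<comment> \<open>The larger endpoint value depends on whether \<open>c\<close> is above or below one.\<close>
  define e where "e = max (c powr a) (c powr (a + 1))"
  have e: "e > 0" "c powr x \<le> e" if "x \<in> {a..a+1}" for x
  proof -
    show "e > 0" using \<open>c > 0\<close> by (simp add: e_def less_max_iff_disj)
    show "c powr x \<le> e"
    proof (cases "c \<ge> 1")
      case True
      then have "c powr x \<le> c powr (a + 1)" using that by (intro powr_mono) auto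
      then show ?thesis by (simp add: e_def)
    next
      case False
      then have "c powr x \<le> c powr a" using that \<open>c > 0\<close> by (intro powr_mono') auto
      then show ?thesis by (simp add: e_def)
    qed
  qed
  show thesis
  proof (rule that[of "d / e" a])
    show "d / e > 0" using d(1) e(1)[of a] by simp
    fix y assume "y \<ge> a"
    define k where "k = nat \<lfloor>y - a\<rfloor>"
    define x where "x = y - real k"
    have x: "x \<in> {a..a+1}" using \<open>y \<ge> a\<close> unfolding x_def k_def by (simp; linarith)
    have "c powr y = c ^ k * c powr x"
      using \<open>c > 0\<close> by (simp add: x_def powr_diff powr_realpow)
    then have "d / e * c powr y = c ^ k * (d * (c powr x / e))" by simp
    also have "\<dots> \<le> c ^ k * (d * 1)"
      using e[OF x] d(1) \<open>c > 0\<close> by (intro mult_left_mono) auto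
    also have "\<dots> \<le> c ^ k * V x"
      using d(2)[OF x] \<open>c > 0\<close> by (intro mult_left_mono) auto
    also have "\<dots> \<le> V y"
      using steps[of x k] x by (simp add: x_def)
    finally show "d / e * c powr y \<le> V y" .
  qed
qed

text \<open>
  Up to the factor \<open>Gamma c\<close> this is the binomial series of \<open>(1 - q)\<close> to the power \<open>- c\<close>.
\<close>
lemma summable_negative_binomial:
  fixes c q :: real
  assumes "c > 0" "\<bar>q\<bar> < 1"
  shows "summable (\<lambda>k. Gamma (real k + c) * q ^ k / fact k)"
proof -
  have c: "c \<notin> \<int>\<^sub>\<le>\<^sub>0" using \<open>c > 0\<close> by (auto elim!: nonpos_Ints_cases)
  have "summable (\<lambda>k. (- c gchoose k) * (- q) ^ k)"
    using gen_binomial_real[of "- q" "- c"] assms by (auto simp: summable_def)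
  moreover have "(- c gchoose k) * (- q) ^ k = Gamma (real k + c) * q ^ k / fact k / Gamma c" for k
    using pochhammer_Gamma[OF c, of k]
    by (simp add: gbinomial_pochhammer power_minus[of q] add.commute mult_ac)
  ultimately have "summable (\<lambda>k. Gamma (real k + c) * q ^ k / fact k / Gamma c * Gamma c)"
    by (intro summable_mult2) simp
  then show ?thesis using Gamma_real_pos[OF \<open>c > 0\<close>] by simp
qed

text \<open>
  The growth of \<open>V\<close> along the progression \<open>\<alpha> k + b\<close> contributes a factor \<open>c\<^sup>\<alpha>\<close> per step to the
  denominators, leaving a negative binomial series with ratio \<open>\<rho> / c\<^sup>\<alpha>\<close>.
\<close>
lemma Z_series_summable:
  assumes adm: "admissible_pair \<phi> V" and "\<alpha> > 0" "b > 0" "\<gamma> > 0" "\<rho> > 0"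
    and "c > 0" "\<forall>\<^sub>F x in at_top. c \<le> \<phi> x" "\<rho> < c powr \<alpha>"
  shows "summable (\<lambda>k. Gamma (real k + \<gamma>) * \<rho> ^ k / (fact k * V (\<alpha> * real k + b)))"
proof -
  obtain D a where D: "D > 0" "\<And>y. y \<ge> a \<Longrightarrow> D * c powr y \<le> V y"
    using admissible_pair_growth[OF adm \<open>c > 0\<close> assms(7)] by blast
  note Vpos = admissible_pair_pos(2)[OF adm]
  define q where "q = \<rho> / c powr \<alpha>"
  have "\<bar>q\<bar> < 1" using assms by (simp add: q_def)
  then have "summable (\<lambda>k. Gamma (real k + \<gamma>) * q ^ k / fact k * (1 / (D * c powr b)))"
    using \<open>\<gamma> > 0\<close> by (intro summable_mult2 summable_negative_binomial)
  moreover have "\<forall>\<^sub>F k in sequentially.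
      norm (Gamma (real k + \<gamma>) * \<rho> ^ k / (fact k * V (\<alpha> * real k + b)))
        \<le> Gamma (real k + \<gamma>) * q ^ k / fact k * (1 / (D * c powr b))"
  proof -
    have "\<forall>\<^sub>F k in sequentially. real k \<ge> a / \<alpha>"
      using filterlim_real_sequentially by (simp add: filterlim_at_top)
    then show ?thesis
    proof eventually_elim
      case (elim k)
      define y where "y = \<alpha> * real k + b"
      have y: "y > 0" "y \<ge> a"
        using elim \<open>\<alpha> > 0\<close> \<open>b > 0\<close> by (auto simp: y_def field_simps intro!: add_pos_nonneg)
      have "c powr y = (c powr \<alpha>) ^ k * c powr b"
        using \<open>c > 0\<close> by (simp add: y_def powr_add powr_powr[symmetric] powr_realpow)
      then have "Gamma (real k + \<gamma>) * q ^ k / fact k * (1 / (D * c powr b)) =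
          Gamma (real k + \<gamma>) * \<rho> ^ k / (fact k * (D * c powr y))"
        by (simp add: q_def power_divide)
      moreover have "Gamma (real k + \<gamma>) > 0" using \<open>\<gamma> > 0\<close> by (intro Gamma_real_pos) simp
      then have "Gamma (real k + \<gamma>) * \<rho> ^ k / (fact k * V y)
          \<le> Gamma (real k + \<gamma>) * \<rho> ^ k / (fact k * (D * c powr y))"
        using D y Vpos[OF y(1)] \<open>c > 0\<close> \<open>\<rho> > 0\<close>
        by (intro divide_left_mono mult_left_mono mult_pos_pos) auto
      moreover have "Gamma (real k + \<gamma>) * \<rho> ^ k / (fact k * V y) \<ge> 0"
        using \<open>Gamma (real k + \<gamma>) > 0\<close> Vpos[OF y(1)] \<open>\<rho> > 0\<close> by simp
      ultimately show ?case by (simp add: y_def)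
    qed
  qed
  ultimately show ?thesis by (rule summable_comparison_test_ev[rotated])
qed

text \<open>
  Any \<open>c\<close> strictly between \<open>\<rho>\<close> to the power \<open>1/\<alpha>\<close> and \<open>L\<close> works. Comparing these two as extended reals
  covers the case \<open>L = \<infinity>\<close>; a vanishing \<open>L\<close> is excluded since \<open>0 powr \<alpha> = 0\<close>.
\<close>
lemma obtain_growth_rate:
  fixes \<phi> :: "real \<Rightarrow> real" and L :: ereal
  assumes lim: "((\<lambda>x. ereal (\<phi> x)) \<longlongrightarrow> L) at_top" and pos: "\<And>x. x > 0 \<Longrightarrow> \<phi> x > 0"
    and "\<alpha> > 0" "\<rho> > 0" and less: "L \<noteq> \<infinity> \<Longrightarrow> \<rho> < real_of_ereal L powr \<alpha>"
  obtains c where "c > 0" "\<forall>\<^sub>F x in at_top. c \<le> \<phi> x" "\<rho> < c powr \<alpha>"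
proof -
  define u where "u = \<rho> powr (1 / \<alpha>)"
  have u: "u > 0" "u powr \<alpha> = \<rho>"
    using assms by (auto simp: u_def powr_powr)
  have L0: "L \<ge> 0"
  proof (rule tendsto_lowerbound[OF lim])
    show "\<forall>\<^sub>F x in at_top. 0 \<le> ereal (\<phi> x)"
      using eventually_gt_at_top[of "0::real"] by (rule eventually_mono) (simp add: pos less_imp_le)
  qed simp
  have "ereal u < L"
  proof (cases L)
    case (real l)
    then have "u powr \<alpha> < l powr \<alpha>" "l \<ge> 0" using less u L0 by auto
    then have "u < l" using \<open>\<alpha> > 0\<close> u by (smt (verit) powr_mono2)
    then show ?thesis using real by simp
  qed (use L0 in auto)
  then obtain c where c: "ereal u < ereal c" "ereal c < L"
    using ereal_dense2 by blast
  show thesis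
  proof (rule that[of c])
    show "c > 0" using c u by simp
    show "\<forall>\<^sub>F x in at_top. c \<le> \<phi> x"
      using order_tendstoD(1)[OF lim c(2)] by eventually_elim simp
    show "\<rho> < c powr \<alpha>" using c u \<open>\<alpha> > 0\<close> powr_less_mono2[of \<alpha> u c] by simp
  qed
qed

section \<open>Factorial moments\<close>

text \<open>
  The law of \<open>X\<close> has the point probabilities as density with respect to counting measure, and
  integrals against counting measure on the naturals are absolutely convergent series.
\<close>
lemma (in prob_space) expectation_nat_valued:
  fixes X :: "'a \<Rightarrow> nat" and f :: "nat \<Rightarrow> real"
  assumes X: "X \<in> M \<rightarrow>\<^sub>M count_space UNIV"
    and sm: "summable (\<lambda>n. norm (prob {\<omega> \<in> space M. X \<omega> = n} * f n))"
  shows "integrable M (\<lambda>\<omega>. f (X \<omega>))"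
    and "expectation (\<lambda>\<omega>. f (X \<omega>)) = (\<Sum>n. prob {\<omega> \<in> space M. X \<omega> = n} * f n)"
proof -
  define p where "p n = prob {\<omega> \<in> space M. X \<omega> = n}" for n
  have distr: "distr M (count_space UNIV) X = density (count_space UNIV) (\<lambda>n. ennreal (p n))"
  proof (rule measure_eqI_countable[of _ UNIV])
    fix n :: nat
    have "X -` {n} \<inter> space M = {\<omega> \<in> space M. X \<omega> = n}" by auto
    then show "emeasure (distr M (count_space UNIV) X) {n} =
        emeasure (density (count_space UNIV) (\<lambda>n. ennreal (p n))) {n}"
      using X by (simp add: emeasure_distr emeasure_density p_def emeasure_eq_measure
          nn_integral_count_space_indicator[symmetric] nn_integral_count_space_finite)
  qed auto
  have p0: "p n \<ge> 0" for n by (simp add: p_def)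
  have int: "integrable (count_space UNIV) (\<lambda>n. p n * f n)"
    using sm by (simp add: integrable_count_space_nat_iff p_def)
  have "integrable (distr M (count_space UNIV) X) f"
    unfolding distr using int p0 by (simp add: integrable_density)
  then show "integrable M (\<lambda>\<omega>. f (X \<omega>))"
    using X by (simp add: integrable_distr_eq)
  have "expectation (\<lambda>\<omega>. f (X \<omega>)) = integral\<^sup>L (distr M (count_space UNIV) X) f"
    using X by (simp add: integral_distr)
  also have "\<dots> = integral\<^sup>L (count_space UNIV) (\<lambda>n. p n * f n)"
    unfolding distr using p0 by (simp add: integral_density)
  also have "\<dots> = (\<Sum>n. p n * f n)"
    using int by (rule integral_count_space_nat)
  finally show "expectation (\<lambda>\<omega>. f (X \<omega>)) = (\<Sum>n. prob {\<omega> \<in> space M. X \<omega> = n} * f n)"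
    by (simp add: p_def)
qed

lemma falling_factorial_eq_fact_div:
  "(\<Prod>i<s. (real (k + s) - real i)) = fact (k + s) / fact k"
proof (induction s)
  case (Suc s)
  have "(\<Prod>i<Suc s. (real (k + Suc s) - real i)) =
      real (k + Suc s) * (\<Prod>i<s. (real (k + s) - real i))"
    by (subst prod.lessThan_Suc_shift) simp
  then show ?case using Suc by simp
qed simp

lemma falling_factorial_eq_0:
  "n < s \<Longrightarrow> (\<Prod>i<s. (real n - real i)) = 0"
  by (auto intro!: prod_zero)

text \<open>
  The term with index \<open>k + s\<close> of the moment series is a constant multiple of the term with index \<open>k\<close>
  of the shifted series, so summability of the latter gives integrability and the value together.
\<close>
theorem proposition7p1:
  fixes \<alpha> \<beta> \<gamma> \<rho> :: real and \<phi> V :: "real \<Rightarrow> real" and L :: ereal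
    and M :: "'w measure" and X :: "'w \<Rightarrow> nat" and s :: nat
  assumes "\<alpha> > 0" and "\<beta> > 0" and "\<gamma> > 0"
    and "admissible_pair \<phi> V"
    and "((\<lambda>x. ereal (\<phi> x)) \<longlongrightarrow> L) at_top"
    and "0 < \<rho>" and "L \<noteq> \<infinity> \<Longrightarrow> \<rho> < real_of_ereal L powr \<alpha>"
    and "prob_space M" and "X \<in> M \<rightarrow>\<^sub>M count_space UNIV"
    and "\<And>n. measure M {\<omega> \<in> space M. X \<omega> = n} =
           Gamma (real n + \<gamma>) * \<rho> ^ n / (fact n * V (\<alpha> * real n + \<beta>)) *
           (1 / Z_series V \<alpha> \<beta> \<gamma> \<rho>)"
  shows "integrable M (\<lambda>\<omega>. \<Prod>i<s. (real (X \<omega>) - real i)) \<and>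
         (\<integral>\<omega>. (\<Prod>i<s. (real (X \<omega>) - real i)) \<partial>M) =
           \<rho> ^ s * (Z_series V \<alpha> (real s * \<alpha> + \<beta>) (\<gamma> + real s) \<rho> / Z_series V \<alpha> \<beta> \<gamma> \<rho>)"
proof -
  interpret prob_space M by fact
  define Z where "Z = Z_series V \<alpha> \<beta> \<gamma> \<rho>"
  define p where "p n = prob {\<omega> \<in> space M. X \<omega> = n}" for n
  define ff where "ff n = (\<Prod>i<s. (real n - real i))" for n
  define T where "T k = Gamma (real k + (\<gamma> + real s)) * \<rho> ^ k /
      (fact k * V (\<alpha> * real k + (real s * \<alpha> + \<beta>)))" for k
  obtain c where c: "c > 0" "\<forall>\<^sub>F x in at_top. c \<le> \<phi> x" "\<rho> < c powr \<alpha>"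
    using obtain_growth_rate[OF assms(5) admissible_pair_pos(1)[OF assms(4)] assms(1,6,7)] by blast
  have "summable T"
    unfolding T_def using assms c
    by (intro Z_series_summable[OF assms(4) _ _ _ _ c]) (auto intro: add_nonneg_pos)
  then have "T sums Z_series V \<alpha> (real s * \<alpha> + \<beta>) (\<gamma> + real s) \<rho>"
    unfolding Z_series_def T_def by (rule summable_sums)
  then have "(\<lambda>k. \<rho> ^ s / Z * T k) sums
      (\<rho> ^ s / Z * Z_series V \<alpha> (real s * \<alpha> + \<beta>) (\<gamma> + real s) \<rho>)"
    by (rule sums_mult)
  moreover have shift: "p (k + s) * ff (k + s) = \<rho> ^ s / Z * T k" for k
  proof -
    have "\<alpha> * real (k + s) + \<beta> = \<alpha> * real k + (real s * \<alpha> + \<beta>)"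
      by (simp add: algebra_simps)
    then show ?thesis
      by (simp add: p_def assms(10) ff_def falling_factorial_eq_fact_div T_def Z_def power_add
          add_ac del: of_nat_add) (simp add: add_ac mult_ac)
  qed
  ultimately have sums_shifted: "(\<lambda>k. p (k + s) * ff (k + s)) sums
      (\<rho> ^ s * (Z_series V \<alpha> (real s * \<alpha> + \<beta>) (\<gamma> + real s) \<rho> / Z))"
    by simp
  have zero: "p n * ff n = 0" if "n < s" for n
    using that by (simp add: ff_def falling_factorial_eq_0)
  have sums: "(\<lambda>n. p n * ff n) sums
      (\<rho> ^ s * (Z_series V \<alpha> (real s * \<alpha> + \<beta>) (\<gamma> + real s) \<rho> / Z))"
    using sums_shifted zero by (subst (asm) sums_zero_iff_shift) auto
  have "p n * ff n \<ge> 0" for n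
  proof (cases "n < s")
    case False
    then obtain k where "n = k + s" by (metis le_add_diff_inverse2 not_less)
    then show ?thesis by (simp add: p_def ff_def falling_factorial_eq_fact_div del: of_nat_add)
  qed (simp add: zero)
  then have "summable (\<lambda>n. norm (p n * ff n))"
    using sums by (simp add: sums_iff)
  then show ?thesis
    using expectation_nat_valued[OF assms(9), of ff] sums
    by (simp add: p_def ff_def Z_def sums_iff)
qed

end
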